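(* Let $k$ be a positive integer and let $E_k(x)=\sum_{n=0}^{\infty}b_{k,n}\frac{x^n}{n!}$ be the exponential generating function of the binomial transform $\{b_{k,n}\}_{n\ge0}$ of the higher order Mersenne numbers. Then $$E_k(x)=\frac{e^{m_kx}-e^{2x}}{2^k-1} .$$
   Context: The Mersenne numbers $\{M_n\}_{n\ge 0}$ are defined by $M_0=0$, $M_1=1$, $M_{n+2}=3M_{n+1}-2M_n$, i.e. $M_n=2^n-1$. The Mersenne-Lucas numbers satisfy the same recurrence with $m_0=2$, $m_1=3$, i.e. $m_n=2^n+1$. For a positive integer $k$, the higher order Mersenne numbers are $M_n^{(k)}=M_{kn}/M_k$ for $n=0,1,2,\dots$, and their binomial transform is $b_{k,n}=\sum_{i=0}^{n}\binom{n}{i}M_i^{(k)}$ for $n\ge 0$. *)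

theory Defs
  imports "HOL-Analysis.Analysis" "HOL-Computational_Algebra.Formal_Power_Series"
begin

fun mersenne :: "nat \<Rightarrow> int" where
  "mersenne 0 = 0"
| "mersenne (Suc 0) = 1"
| "mersenne (Suc (Suc n)) = 3 * mersenne (Suc n) - 2 * mersenne n"

fun mersenne_lucas :: "nat \<Rightarrow> int" where
  "mersenne_lucas 0 = 2"
| "mersenne_lucas (Suc 0) = 3"
| "mersenne_lucas (Suc (Suc n)) = 3 * mersenne_lucas (Suc n) - 2 * mersenne_lucas n"

text \<open>The quotient is taken in an arbitrary field of characteristic 0, so that no
  divisibility fact is built into the definition. It is meaningful only for \<open>k > 0\<close>.\<close>

definition higher_mersenne :: "nat \<Rightarrow> nat \<Rightarrow> 'a::field_char_0" where
  "higher_mersenne k n = of_int (mersenne (k * n)) / of_int (mersenne k)"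

definition binomial_transform :: "(nat \<Rightarrow> 'a::field_char_0) \<Rightarrow> nat \<Rightarrow> 'a" where
  "binomial_transform a n = (\<Sum>i=0..n. of_nat (n choose i) * a i)"

definition mersenne_binomial :: "nat \<Rightarrow> nat \<Rightarrow> 'a::field_char_0" where
  "mersenne_binomial k = binomial_transform (higher_mersenne k)"

definition exponential_gf :: "(nat \<Rightarrow> 'a::field_char_0) \<Rightarrow> 'a fps" where
  "exponential_gf a = Abs_fps (\<lambda>n. a n / fact n)"

end

theory Submission
  imports Defs
begin

text \<open>The binomial transform is linear and sends the powers of c to those of c + 1. As the
  higher order Mersenne numbers are a scaled difference of the powers of 2^k and of 1, their
  transform is the same multiple of m_k^n - 2^n, because 2^k + 1 = m_k
  (\<open>mersenne_binomial_eq\<close>). Powers of c have exponential generating function e^(cx),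
  which gives the formula both for formal series and for convergent ones.\<close>

lemma mersenne_eq: "mersenne n = 2 ^ n - 1"
  by (induction n rule: mersenne.induct) auto

lemma mersenne_lucas_eq: "mersenne_lucas n = 2 ^ n + 1"
  by (induction n rule: mersenne_lucas.induct) auto

text \<open>The binomial theorem with second summand 1.\<close>

lemma binomial_transform_power:
  "binomial_transform (\<lambda>i. c ^ i) n = (c + 1 :: 'a::field_char_0) ^ n"
  by (simp add: binomial_transform_def binomial_ring atMost_atLeast0)

text \<open>Writing 1 as \<open>1 ^ n\<close> makes both terms geometric, so that
  \<open>binomial_transform_power\<close> applies to each.\<close>

lemma higher_mersenne_eq:
  "(higher_mersenne k n :: 'a::field_char_0) = ((2 ^ k) ^ n - 1 ^ n) / (2 ^ k - 1)"
  by (simp add: higher_mersenne_def mersenne_eq power_mult)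

lemma mersenne_binomial_eq:
  "(mersenne_binomial k n :: 'a::field_char_0) =
     (of_int (mersenne_lucas k) ^ n - 2 ^ n) / (2 ^ k - 1)"
proof -
  have "(mersenne_binomial k n :: 'a) =
      (binomial_transform (\<lambda>i. (2 ^ k) ^ i) n - binomial_transform (\<lambda>i. 1 ^ i) n) / (2 ^ k - 1)"
    unfolding mersenne_binomial_def binomial_transform_def higher_mersenne_eq
    by (simp only: sum_subtractf[symmetric] sum_divide_distrib right_diff_distrib times_divide_eq_right)
  then show ?thesis
    unfolding binomial_transform_power by (simp add: mersenne_lucas_eq)
qed

text \<open>Splitting (cx)^n into c^n x^n turns the exponential series at cx into the generating
  function of the powers of c.\<close>

lemma exp_sums_divide:
  fixes c x :: "'a::{real_normed_field,banach}"
  shows "(\<lambda>n. c ^ n * (x ^ n / fact n)) sums exp (c * x)"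
  using exp_converges[of "c * x"]
  by (simp add: scaleR_conv_of_real power_mult_distrib divide_inverse mult_ac)

theorem theorem2p25:
  fixes k :: nat
  assumes "k > 0"
  shows "exponential_gf (mersenne_binomial k :: nat \<Rightarrow> 'a::{real_normed_field,banach}) =
           (fps_exp (of_int (mersenne_lucas k)) - fps_exp 2) / fps_const (2 ^ k - 1)
       \<and> (\<forall>x::'a. (\<lambda>n. mersenne_binomial k n * (x ^ n / fact n)) sums
           ((exp (of_int (mersenne_lucas k) * x) - exp (2 * x)) / (2 ^ k - 1)))"
proof (intro conjI allI)
  \<comment> \<open>Keeping \<open>of_int\<close> outermost lets characteristic 0 reduce this to 2^k
    \<noteq> 1 in the integers.\<close>
  have "(of_int (mersenne k) :: 'a) \<noteq> 0"
    using assms by (simp add: mersenne_eq del: of_int_diff of_int_power)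
  then have nz: "(2 ^ k - 1 :: 'a) \<noteq> 0"
    by (simp add: mersenne_eq)
  \<comment> \<open>By \<open>nz\<close> the constant divisor is a unit, so the quotient of formal
    series can be compared coefficientwise.\<close>
  show "exponential_gf (mersenne_binomial k :: nat \<Rightarrow> 'a) =
      (fps_exp (of_int (mersenne_lucas k)) - fps_exp 2) / fps_const (2 ^ k - 1)"
    using nz by (intro fps_ext)
      (simp add: exponential_gf_def mersenne_binomial_eq fps_divide_unit fps_const_inverse
        divide_inverse right_diff_distrib mult_ac)
next
  fix x :: 'a
  show "(\<lambda>n. mersenne_binomial k n * (x ^ n / fact n)) sums
      ((exp (of_int (mersenne_lucas k) * x) - exp (2 * x)) / (2 ^ k - 1))"
    using sums_divide[OF sums_diff[OF exp_sums_divide exp_sums_divide],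
        of "of_int (mersenne_lucas k)" x 2 x "2 ^ k - 1"]
    by (simp only: mersenne_binomial_eq left_diff_distrib[symmetric] times_divide_eq_left)
qed

end
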